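(* Let $\tilde{A}=\widehat{A}+\epsilon_2\widehat{A}_{0}=A_{0}+\epsilon_1 A_{1}+\epsilon_2A_{2}+\epsilon_1 \epsilon_2A_{3}$ be an $n\times n$ hyper-dual matrix (with $\widehat{A}=A_0+\epsilon_1A_1$, $\widehat{A}_0=A_2+\epsilon_1A_3$, $A_i\in\mathbb{R}^{n\times n}$) such that the dual index of $\widehat{A}$ is 1. Then the following statements are equivalent: (i) The hyper-dual group generalized inverse (HDGGI) $\tilde A^{\#}$ of $\tilde{A}$ exists. (ii) $$\tilde{A}=P\begin{bmatrix} C & 0\\ 0 & 0 \end{bmatrix}P^{-1}+\epsilon_1 P\begin{bmatrix} B_{1} & B_{2}\\ B_{3} & 0 \end{bmatrix}P^{-1}+\epsilon_2\left(P\begin{bmatrix} Y_{1} & Y_{2}\\ Y_{3} & 0 \end{bmatrix}P^{-1}+\epsilon_1 P\begin{bmatrix} Z_{1} & Z_{2}\\ Z_{3} & Z_{4} \end{bmatrix}P^{-1}\right)$$ for some nonsingular real matrices $P$ and $C$ of orders $n$ and $r$, respectively, and some real matrices $B_i$, $Y_i$, $Z_i$ of appropriate sizes that satisfy $Z_{4}=B_{3}C^{-1}Y_{2}+Y_{3}C^{-1}B_{2}$. (iii) $(I-\widehat{A}\widehat{A}^{\#})\widehat{A}_{0}(I-\widehat{A}\widehat{A}^{\#})=0$. (iv) $(I-A_{0}A_{0}^{\#})A_{1}(I-A_{0}A_{0}^{\#})= (I-A_{0}A_{0}^{\#})A_{2}(I-A_{0}A_{0}^{\#})= A_{3}-A_{1}A_{0}^{\#}A_{2}-A_{2}A_{0}^{\#}A_{1}=0$.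 Furthermore, if the HDGGI of $\tilde{A}$ exists, then $$\tilde{A}^{\#}=\widehat{A}^{\#}+\epsilon_2\left(-\widehat{A}^{\#}\widehat{A}_{0}\widehat{A}^{\#}+(\widehat{A}^{\#})^{2}\widehat{A}_{0}(I-\widehat{A}\widehat{A}^{\#})+(I-\widehat{A}\widehat{A}^{\#})\widehat{A}_{0}(\widehat{A}^{\#})^{2}\right).$$
   Context: Dual numbers are elements $a+\epsilon_1 a_0$ with $a,a_0\in\mathbb{R}$, $\epsilon_1\neq0$, $\epsilon_1^2=0$. Hyper-dual numbers are elements $a_0+\epsilon_1a_1+\epsilon_2a_2+\epsilon_1\epsilon_2a_3$ with $a_i\in\mathbb{R}$, where $\epsilon_1,\epsilon_2$ commute, $\epsilon_1^2=\epsilon_2^2=0$ and $\epsilon_1\epsilon_2\ne0$ (i.e. the commutative ring $\mathbb{R}[\epsilon_1,\epsilon_2]/(\epsilon_1^2,\epsilon_2^2)$). An $n\times n$ dual matrix is $\widehat{A}=A_0+\epsilon_1A_1$ with $A_0,A_1\in\mathbb{R}^{n\times n}$; an $n\times n$ hyper-dual matrix is $\tilde A=\widehat A+\epsilon_2\widehat A_0$ with $\widehat A=A_0+\epsilon_1A_1$ and $\widehat A_0=A_2+\epsilon_1A_3$ dual matrices. The group inverse of a square matrix $M$ (real, dual or hyper-dual) is the (unique, if it exists) matrix $G=M^{\#}$ of the same type with $MGM=M$, $GMG=G$, $MG=GM$. For hyper-dual matrices it is called the hyper-dual group generalized inverse (HDGGI). A dual matrix $\widehat A$ has dual index 1 if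 the range spaces of $\widehat A^2$ and $\widehat A$ (as maps on dual vectors) coincide. It is known that for $\widehat A=A_0+\epsilon_1A_1$ this is equivalent to the existence of $\widehat A^{\#}$, and then $A_0^{\#}$ exists too.
   Formalization: In (iv) the third equation is formalized as (I-A0A0#)(A3-A1A0#A2-A2A0#A1)(I-A0A0#)=0; without the outer factors the claim is false, e.g. n=1, A0=A3=1, A1=A2=0, where the HDGGI exists but A3-A1A0#A2-A2A0#A1=1. *)

theory Defs
  imports Complex_Main "Jordan_Normal_Form.Gauss_Jordan_Elimination"
begin

section \<open>Dual and hyper-dual numbers\<close>

text \<open>\<open>Dual a b\<close> is \<open>a + \<epsilon> b\<close> with \<open>\<epsilon>\<^sup>2 = 0\<close>. The coefficient ring is arbitrary, so
  that the construction can be iterated.\<close>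

datatype 'a dual_num = Dual (re_part: 'a) (eps_part: 'a)

instantiation dual_num :: (comm_ring_1) comm_ring_1
begin

definition "0 = Dual 0 0"
definition "1 = Dual 1 0"
definition "x + y = Dual (re_part x + re_part y) (eps_part x + eps_part y)"
definition "- x = Dual (- re_part x) (- eps_part x)"
definition "x - y = Dual (re_part x - re_part y) (eps_part x - eps_part (y :: 'a dual_num))"
definition "x * y = Dual (re_part x * re_part y)
                         (re_part x * eps_part y + eps_part x * re_part y)"

instance
  by standard
    (auto simp: zero_dual_num_def one_dual_num_def plus_dual_num_def uminus_dual_num_def
      minus_dual_num_def times_dual_num_def algebra_simps)

end

definition of_base :: "'a::comm_ring_1 \<Rightarrow> 'a dual_num" where
  "of_base a = Dual a 0"

definition eps :: "'a::comm_ring_1 dual_num" where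
  "eps = Dual 0 1"

type_synonym dual = "real dual_num"

text \<open>\<open>\<real>[\<epsilon>\<^sub>1,\<epsilon>\<^sub>2]/(\<epsilon>\<^sub>1\<^sup>2,\<epsilon>\<^sub>2\<^sup>2)\<close> as \<open>D[\<epsilon>\<^sub>2]/(\<epsilon>\<^sub>2\<^sup>2)\<close> over \<open>D = \<real>[\<epsilon>\<^sub>1]/(\<epsilon>\<^sub>1\<^sup>2)\<close>: the outer \<^const>\<open>eps\<close>
  is \<open>\<epsilon>\<^sub>2\<close> and the embedded inner one is \<open>\<epsilon>\<^sub>1\<close>.\<close>

type_synonym hyperdual = "dual dual_num"

abbreviation eps1 :: hyperdual where "eps1 \<equiv> of_base eps"
abbreviation eps2 :: hyperdual where "eps2 \<equiv> eps"
abbreviation hd_of_real :: "real \<Rightarrow> hyperdual" where "hd_of_real a \<equiv> of_base (of_base a)"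

lemmas dual_num_defs =
  zero_dual_num_def one_dual_num_def plus_dual_num_def uminus_dual_num_def
  minus_dual_num_def times_dual_num_def of_base_def eps_def

lemma Dual_eq: "Dual a b = of_base a + eps * of_base b"
  by (simp add: dual_num_defs)

lemma eps_relations:
  "eps1 * eps1 = 0" "eps2 * eps2 = 0" "eps1 \<noteq> 0" "eps2 \<noteq> 0" "eps1 * eps2 \<noteq> 0"
  by (simp_all add: dual_num_defs)

lemma hyperdual_components:
  "Dual (Dual a0 a1) (Dual a2 a3) =
     hd_of_real a0 + eps1 * hd_of_real a1 + eps2 * hd_of_real a2 + eps1 * eps2 * hd_of_real a3"
  by (simp add: dual_num_defs)


section \<open>Matrices\<close>

text \<open>\<open>dual_mat M N\<close> is \<open>M + \<epsilon> N\<close>. For real \<open>M\<close>, \<open>N\<close> this is a dual matrix with \<open>\<epsilon> = \<epsilon>\<^sub>1\<close>, for dual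
  \<open>M\<close>, \<open>N\<close> a hyper-dual matrix with \<open>\<epsilon> = \<epsilon>\<^sub>2\<close>.\<close>

definition dual_mat :: "'a::comm_ring_1 mat \<Rightarrow> 'a mat \<Rightarrow> 'a dual_num mat" where
  "dual_mat M N = map_mat of_base M + eps \<cdot>\<^sub>m map_mat of_base N"

lemma dual_mat_index:
  assumes "M \<in> carrier_mat n m" "N \<in> carrier_mat n m" "i < n" "j < m"
  shows "dual_mat M N $$ (i, j) = Dual (M $$ (i, j)) (N $$ (i, j))"
  using assms by (simp add: dual_mat_def Dual_eq)

definition is_group_inverse :: "'a::comm_ring_1 mat \<Rightarrow> 'a mat \<Rightarrow> bool" where
  "is_group_inverse M G \<longleftrightarrow>
     (\<exists>n. M \<in> carrier_mat n n \<and> G \<in> carrier_mat n n) \<and>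
     M * G * M = M \<and> G * M * G = G \<and> M * G = G * M"

definition has_group_inverse :: "'a::comm_ring_1 mat \<Rightarrow> bool" where
  "has_group_inverse M \<longleftrightarrow> (\<exists>G. is_group_inverse M G)"

text \<open>Unspecified if \<open>M\<close> has no group inverse.\<close>

definition group_inverse :: "'a::comm_ring_1 mat \<Rightarrow> 'a mat"  ("_\<^sup>#" [1000] 1000) where
  "M\<^sup># = (THE G. is_group_inverse M G)"

lemma group_inverse_unique:
  assumes G: "is_group_inverse M G" and H: "is_group_inverse M H"
  shows "G = H"
proof -
  obtain n where c: "M \<in> carrier_mat n n" "G \<in> carrier_mat n n"
    using G unfolding is_group_inverse_def by blast
  have H_c: "H \<in> carrier_mat n n"
    using H c unfolding is_group_inverse_def by auto
  note assoc = assoc_mult_mat[of _ n n _ n _ n]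
  have g: "M * G * M = M" "G * M * G = G" "M * G = G * M"
    and h: "M * H * M = M" "H * M * H = H" "M * H = H * M"
    using G H unfolding is_group_inverse_def by auto
  have "M * G = (M * H * M) * G" using h by simp
  also have "\<dots> = (H * M) * (M * G)" using c H_c h(3) by (simp add: assoc)
  also have "\<dots> = (H * M) * (G * M)" using g by simp
  also have "\<dots> = H * (M * G * M)" using c H_c by (simp add: assoc)
  also have "\<dots> = H * M" using g by simp
  finally have e: "M * G = H * M" .
  have "G = (M * G) * G" using g by simp
  also have "\<dots> = H * (M * G)" using e c H_c by (simp add: assoc)
  also have "\<dots> = H * (M * H)" using e h(3) by simp
  also have "\<dots> = H" using h(2) c H_c by (simp add: assoc)
  finally show ?thesis .
qed

lemma group_inverse_eqI: "is_group_inverse M G \<Longrightarrow> M\<^sup># = G"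
  unfolding group_inverse_def using group_inverse_unique by blast

definition mat_range :: "'a::comm_ring_1 mat \<Rightarrow> 'a vec set" where
  "mat_range M = {M *\<^sub>v x | x. x \<in> carrier_vec (dim_col M)}"

definition dual_index_one :: "dual mat \<Rightarrow> bool" where
  "dual_index_one M \<longleftrightarrow> square_mat M \<and> mat_range (M ^\<^sub>m 2) = mat_range M"

text \<open>Ordinary inverse, used only for nonsingular matrices.\<close>

abbreviation minv :: "real mat \<Rightarrow> real mat" where
  "minv M \<equiv> the (mat_inverse M)"

end

theory Submission
  imports Defs "Jordan_Normal_Form.Determinant"
begin

text \<open>Over a commutative ring let \<open>A\<close> have group inverse \<open>G\<close> and put \<open>E = 1 - A G\<close>. Comparing
  coefficients of \<open>\<epsilon>\<close>, \<open>A + \<epsilon> B\<close> has a group inverse iff \<open>E B E = 0\<close>, and the inverse is then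
  explicit. Applied over the dual numbers this is (iii) together with the final formula; applied
  over the reals it computes \<open>I - M M\<^sup># = E - \<epsilon> (E B G + G B E)\<close> for
  \<open>M = A + \<epsilon> B\<close> and turns (iii) into (iv). For (ii), \<open>A\<^sub>0 = A\<^sub>0\<^sup>2 X\<close> forces the core of a rank factorisation of \<open>A\<^sub>0\<close>
  to be invertible, so \<open>A\<^sub>0\<close> is similar to \<open>diag(C, 0)\<close>; in that basis \<open>E X E\<close> is the lower right
  block of \<open>X\<close>.\<close>

section \<open>Group inverses of dual matrices\<close>

lemma dual_mat_carrier [simp]:
  "M \<in> carrier_mat n m \<Longrightarrow> N \<in> carrier_mat n m \<Longrightarrow> dual_mat M N \<in> carrier_mat n m"
  by (simp add: dual_mat_def)

lemma dual_mat_eq_iff: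
  assumes "M \<in> carrier_mat n m" "N \<in> carrier_mat n m"
    "M' \<in> carrier_mat n m" "N' \<in> carrier_mat n m"
  shows "dual_mat M N = dual_mat M' N' \<longleftrightarrow> M = M' \<and> N = N'"
proof
  assume eq: "dual_mat M N = dual_mat M' N'"
  have "Dual (M $$ (i, j)) (N $$ (i, j)) = Dual (M' $$ (i, j)) (N' $$ (i, j))"
    if "i < n" "j < m" for i j
    using eq that assms by (metis dual_mat_index)
  then show "M = M' \<and> N = N'"
    using assms by (auto intro!: eq_matI)
qed simp

lemma dual_mat_cases:
  assumes "X \<in> carrier_mat n m"
  obtains M N where "M \<in> carrier_mat n m" "N \<in> carrier_mat n m" "X = dual_mat M N"
proof
  show "map_mat re_part X \<in> carrier_mat n m" "map_mat eps_part X \<in> carrier_mat n m"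
    using assms by auto
  then show "X = dual_mat (map_mat re_part X) (map_mat eps_part X)"
    using assms by (intro eq_matI) (auto simp: dual_mat_def Dual_eq[symmetric])
qed

lemma re_part_sum: "re_part (sum f A) = (\<Sum>x\<in>A. re_part (f x))"
  by (induction A rule: infinite_finite_induct) (simp_all add: dual_num_defs)

lemma eps_part_sum: "eps_part (sum f A) = (\<Sum>x\<in>A. eps_part (f x))"
  by (induction A rule: infinite_finite_induct) (simp_all add: dual_num_defs)

lemma mult_dual_mat:
  assumes "A \<in> carrier_mat n m" "B \<in> carrier_mat n m" "C \<in> carrier_mat m k" "D \<in> carrier_mat m k"
  shows "dual_mat A B * dual_mat C D = dual_mat (A * C) (A * D + B * C)"
proof (rule eq_matI)
  fix i j assume "i < dim_row (dual_mat (A * C) (A * D + B * C))"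
    "j < dim_col (dual_mat (A * C) (A * D + B * C))"
  then have ij: "i < n" "j < k"
    using assms by (auto simp: dual_mat_def)
  have "(dual_mat A B * dual_mat C D) $$ (i, j) =
      (\<Sum>l\<in>{0..<m}. dual_mat A B $$ (i, l) * dual_mat C D $$ (l, j))"
    using assms ij by (simp add: scalar_prod_def dual_mat_def)
  also have "\<dots> = (\<Sum>l\<in>{0..<m}. Dual (A $$ (i, l)) (B $$ (i, l)) * Dual (C $$ (l, j)) (D $$ (l, j)))"
    using assms ij by (intro sum.cong) (simp_all add: dual_mat_index)
  \<comment> \<open>Both projections are additive over finite sums, so comparing
    \<open>re_part\<close> and \<open>eps_part\<close> splits the product into ordinary entry
    sums.\<close>
  also have "\<dots> = Dual ((A * C) $$ (i, j)) ((A * D + B * C) $$ (i, j))"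
    using assms ij
    by (intro dual_num.expand)
      (simp add: re_part_sum eps_part_sum times_dual_num_def scalar_prod_def sum.distrib)
  also have "\<dots> = dual_mat (A * C) (A * D + B * C) $$ (i, j)"
    using assms ij by (subst dual_mat_index[of _ n k]) auto
  finally show "(dual_mat A B * dual_mat C D) $$ (i, j) = dual_mat (A * C) (A * D + B * C) $$ (i, j)" .
qed (use assms in \<open>auto simp: dual_mat_def\<close>)

lemma minus_dual_mat:
  assumes "A \<in> carrier_mat n m" "B \<in> carrier_mat n m" "C \<in> carrier_mat n m" "D \<in> carrier_mat n m"
  shows "dual_mat A B - dual_mat C D = dual_mat (A - C) (B - D)"
  using assms
  by (intro eq_matI) (auto simp: dual_mat_def dual_num_defs)

lemma one_dual_mat: "(1\<^sub>m n :: 'a::comm_ring_1 dual_num mat) = dual_mat (1\<^sub>m n) (0\<^sub>m n n)"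
  by (intro eq_matI) (auto simp: dual_mat_def dual_num_defs)

lemma zero_dual_mat: "(0\<^sub>m n m :: 'a::comm_ring_1 dual_num mat) = dual_mat (0\<^sub>m n m) (0\<^sub>m n m)"
  by (intro eq_matI) (auto simp: dual_mat_def dual_num_defs)

lemma is_group_inverse_iff:
  assumes "M \<in> carrier_mat n n"
  shows "is_group_inverse M G \<longleftrightarrow>
    G \<in> carrier_mat n n \<and> M * G * M = M \<and> G * M * G = G \<and> M * G = G * M"
  using assms by (auto simp: is_group_inverse_def)

text \<open>The three defining equations split into coefficients: the constant ones say that
  \<open>G\<close> is a group inverse of \<open>A\<close>, and the \<epsilon> ones are affine linear
  in the unknown \<open>N\<close>.\<close>

lemma dual_mat_is_group_inverse_iff:
  assumes c: "A \<in> carrier_mat n n" "B \<in> carrier_mat n n" "G \<in> carrier_mat n n" "N \<in> carrier_mat n n"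
  shows "is_group_inverse (dual_mat A B) (dual_mat G N) \<longleftrightarrow> is_group_inverse A G \<and>
    A * G * B + (A * N + B * G) * A = B \<and> G * A * N + (G * B + N * A) * G = N \<and>
    A * N + B * G = G * B + N * A"
proof -
  note m = mult_carrier_mat[of _ n n _ n] add_carrier_mat[of _ n n]
  have 1: "dual_mat A B * dual_mat G N * dual_mat A B =
      dual_mat (A * G * A) (A * G * B + (A * N + B * G) * A)"
    using c by (simp add: mult_dual_mat[of _ n n _ _ n] m del: assoc_mult_mat)
  have 2: "dual_mat G N * dual_mat A B * dual_mat G N =
      dual_mat (G * A * G) (G * A * N + (G * B + N * A) * G)"
    using c by (simp add: mult_dual_mat[of _ n n _ _ n] m del: assoc_mult_mat)
  have 3: "dual_mat A B * dual_mat G N = dual_mat (A * G) (A * N + B * G)"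
    "dual_mat G N * dual_mat A B = dual_mat (G * A) (G * B + N * A)"
    using c by (simp_all add: mult_dual_mat[of _ n n _ _ n])
  have 4: "dual_mat A B \<in> carrier_mat n n" "dual_mat G N \<in> carrier_mat n n"
    using c by simp_all
  show ?thesis
    \<comment> \<open>The triple products are rewritten before \<open>3\<close>, whose rules match
      their inner factors and would hide them.\<close>
    unfolding is_group_inverse_iff[OF 4(1)] is_group_inverse_iff[OF c(1)] 1 2 unfolding 3
    using c 4(2) by (simp add: dual_mat_eq_iff[of _ n n] m del: assoc_mult_mat) blast
qed

section \<open>Existence criterion and explicit inverse over a commutative ring\<close>

context
  fixes n :: nat
begin

text \<open>The ring laws for matrices carry size conditions; with all sizes fixed to
  \<open>n\<close> the simplifier can discharge these and bring products into right-associated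
  words.\<close>

private lemmas mat_ring_simps =
  assoc_mult_mat[of _ n n _ n _ n]
  add_mult_distrib_mat[of _ n n _ _ n] mult_add_distrib_mat[of _ n n _ n]
  minus_mult_distrib_mat[of _ n n _ _ n] mult_minus_distrib_mat[of _ n n _ n]
  left_mult_one_mat[of _ n n] right_mult_one_mat[of _ n n]
  mult_carrier_mat[of _ n n _ n] minus_carrier_mat[of _ n n] add_carrier_mat[of _ n n]
  uminus_carrier_iff_mat[of _ n n]

context
  fixes A G :: "'a::comm_ring_1 mat"
  assumes A: "A \<in> carrier_mat n n" and AG: "is_group_inverse A G"
begin

private lemma G: "G \<in> carrier_mat n n"
  using A AG by (simp add: is_group_inverse_iff)

text \<open>Confluent rules bringing every word in \<open>A\<close> and \<open>G\<close> to one of the forms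
  \<open>A\<^sup>k\<close>, \<open>G\<^sup>k\<close>, \<open>A G\<close>.\<close>

private lemma word_simps:
  "G * A = A * G" "A * (A * G) = A" "A * (G * G) = G"
  "X \<in> carrier_mat n n \<Longrightarrow> G * (A * X) = A * (G * X)"
  "X \<in> carrier_mat n n \<Longrightarrow> A * (A * (G * X)) = A * X"
  "X \<in> carrier_mat n n \<Longrightarrow> A * (G * (G * X)) = G * X"
proof -
  have *: "A * G * A = A" "G * A * G = G" "A * G = G * A"
    using AG A unfolding is_group_inverse_iff[OF A] by blast+
  show 1: "G * A = A * G"
    using * by simp
  note assoc = assoc_mult_mat[of _ n n _ n _ n]
  have "A * (A * G) = A * G * A"
    using A G by (simp add: assoc 1)
  then show 2: "A * (A * G) = A"
    by (simp only: *(1))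
  have "A * (G * G) = G * A * G"
    using A G 1 assoc by metis
  then show 3: "A * (G * G) = G"
    by (simp only: *(2))
  show "G * (A * X) = A * (G * X)" if "X \<in> carrier_mat n n"
  proof -
    have "G * A * X = A * G * X"
      by (simp only: 1)
    then show ?thesis
      using that A G by (simp only: assoc)
  qed
  show "A * (A * (G * X)) = A * X" if "X \<in> carrier_mat n n"
  proof -
    have "A * (A * (G * X)) = A * (A * G) * X"
      using that A G by (simp add: assoc)
    then show ?thesis by (simp only: 2)
  qed
  show "A * (G * (G * X)) = G * X" if "X \<in> carrier_mat n n"
  proof -
    have "A * (G * (G * X)) = A * (G * G) * X"
      using that A G by (simp add: assoc)
    then show ?thesis by (simp only: 3)
  qed
qed

text \<open>With \<open>E = 1 - A G\<close>, the proposed \<epsilon> coefficient turns the left side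
  of the first linear equation into \<open>B - E B E\<close>, which is where the hypothesis enters;
  the other two equations hold for every \<open>B\<close>.\<close>

lemma dual_group_inverse:
  assumes B: "B \<in> carrier_mat n n"
    and z: "(1\<^sub>m n - A * G) * B * (1\<^sub>m n - A * G) = 0\<^sub>m n n"
  shows "is_group_inverse (dual_mat A B) (dual_mat G
      (- (G * B * G) + (G ^\<^sub>m 2) * B * (1\<^sub>m n - A * G) + (1\<^sub>m n - A * G) * B * (G ^\<^sub>m 2)))"
    (is "is_group_inverse _ (dual_mat G ?N)")
proof -
  define N where "N = ?N"
  have N: "N \<in> carrier_mat n n"
    unfolding N_def using A G B by (simp add: numeral_2_eq_2 mat_ring_simps)
  have Nx: "N = - (G * (B * G)) + (G * (G * B) - G * (G * (B * (A * G))))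
      + (B * (G * G) - A * (G * (B * (G * G))))"
    unfolding N_def using A G B
    by (simp add: numeral_2_eq_2 mat_ring_simps)
  \<comment> \<open>\<open>eq_matI\<close> passes to entries, while removing
    \<open>index_mult_mat(1)\<close> keeps every product of matrices as an atom. Once the words are
    normalised, only an additive identity in the coefficient ring is left.\<close>
  have "A * G * B + (A * N + B * G) * A = B - (1\<^sub>m n - A * G) * B * (1\<^sub>m n - A * G)"
    unfolding Nx using A G B
    by (intro eq_matI) (simp_all add: mat_ring_simps word_simps del: index_mult_mat(1))
  then have 1: "A * G * B + (A * N + B * G) * A = B"
    unfolding z using B by auto
  have 2: "G * A * N + (G * B + N * A) * G = N"
    unfolding Nx using A G B
    by (intro eq_matI) (simp_all add: mat_ring_simps word_simps del: index_mult_mat(1))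
  have 3: "A * N + B * G = G * B + N * A"
    unfolding Nx using A G B
    by (intro eq_matI) (simp_all add: mat_ring_simps word_simps del: index_mult_mat(1))
  have "is_group_inverse (dual_mat A B) (dual_mat G N)"
    unfolding dual_mat_is_group_inverse_iff[OF A B G N] using AG 1 2 3 by blast
  then show ?thesis
    by (simp only: N_def)
qed

text \<open>The constant coefficient of \<open>X\<close> is \<open>G\<close> by uniqueness. The
  first \<epsilon> equation then writes \<open>B\<close> as a sum of words that start or end with
  \<open>A\<close>, and \<open>E A = A E = 0\<close> kills each of them between two copies of
  \<open>E = 1 - A G\<close>.\<close>

lemma dual_group_inverse_imp:
  assumes B: "B \<in> carrier_mat n n" and AG: "is_group_inverse (dual_mat A B) X"
  shows "(1\<^sub>m n - A * G) * B * (1\<^sub>m n - A * G) = 0\<^sub>m n n"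
proof -
  have "X \<in> carrier_mat n n"
    using AG is_group_inverse_iff[OF dual_mat_carrier[OF A B]] by blast
  then obtain K L where KL: "K \<in> carrier_mat n n" "L \<in> carrier_mat n n" "X = dual_mat K L"
    by (rule dual_mat_cases)
  have K: "is_group_inverse A K" and eq: "A * K * B + (A * L + B * K) * A = B"
    using AG unfolding KL(3) dual_mat_is_group_inverse_iff[OF A B KL(1,2)] by blast+
  from K have "K = G"
    using \<open>is_group_inverse A G\<close> by (rule group_inverse_unique)
  have "(1\<^sub>m n - A * G) * B * (1\<^sub>m n - A * G) =
      (1\<^sub>m n - A * G) * (A * K * B + (A * L + B * K) * A) * (1\<^sub>m n - A * G)"
    by (simp only: eq)
  also have "\<dots> = 0\<^sub>m n n"
    unfolding \<open>K = G\<close> using A G B KL(2)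
    by (intro eq_matI) (simp_all add: mat_ring_simps word_simps del: index_mult_mat(1))
  finally show ?thesis .
qed

text \<open>The two equations are the coefficients of \<open>(A + \<epsilon> B)\<^sup>2 (X +
  \<epsilon> Y) = A + \<epsilon> B\<close>, which is how dual index one will be used. They present
  \<open>B\<close> as a sum of words that start with \<open>A\<close> or end with
  \<open>A G\<close>, and these vanish between the projectors.\<close>

lemma dual_core_condition:
  assumes c: "B \<in> carrier_mat n n" "X \<in> carrier_mat n n" "Y \<in> carrier_mat n n"
    and X: "A * A * X = A" and Y: "A * A * Y + (A * B + B * A) * X = B"
  shows "(1\<^sub>m n - A * G) * B * (1\<^sub>m n - A * G) = 0\<^sub>m n n"
proof -
  \<comment> \<open>Since \<open>G A A = A\<close>, multiplying \<open>A A X = A\<close> by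
    \<open>G\<close> identifies \<open>A X\<close> with the projector \<open>A G\<close>.\<close>
  have "G * (A * A * X) = A * X"
    using A G c by (simp add: mat_ring_simps word_simps)
  then have AX: "A * X = A * G"
    by (simp only: X word_simps(1))
  have BAX: "B * A * X = B * (A * G)" "A * B * X = A * (B * X)"
    using A G c by (simp_all add: mat_ring_simps AX)
  have "A * A * Y + (A * B + B * A) * X = A * (A * Y) + (A * (B * X) + B * (A * G))"
    using A G c by (simp add: mat_ring_simps BAX AX)
  then have Y': "B = A * (A * Y) + (A * (B * X) + B * (A * G))"
    by (simp only: Y)
  have "(1\<^sub>m n - A * G) * B * (1\<^sub>m n - A * G) =
      (1\<^sub>m n - A * G) * (A * (A * Y) + (A * (B * X) + B * (A * G))) * (1\<^sub>m n - A * G)"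
    by (simp only: Y'[symmetric])
  also have "\<dots> = 0\<^sub>m n n"
    using A G c
    by (intro eq_matI) (simp_all add: mat_ring_simps word_simps del: index_mult_mat(1))
  finally show ?thesis .
qed

text \<open>This moves the condition one level down, from dual matrices to their coefficients.
  Expanding \<open>(E - \<epsilon> M) (C + \<epsilon> D) (E - \<epsilon> M)\<close> gives the
  constant term \<open>E C E\<close> and an \<epsilon> term that is the second condition up to
  summands containing \<open>E C E\<close>.\<close>

lemma dual_projector_condition:
  assumes B: "B \<in> carrier_mat n n" "C \<in> carrier_mat n n" "D \<in> carrier_mat n n"
    and z: "(1\<^sub>m n - A * G) * B * (1\<^sub>m n - A * G) = 0\<^sub>m n n"
  shows "(1\<^sub>m n - dual_mat A B * (dual_mat A B)\<^sup>#) * dual_mat C D *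
      (1\<^sub>m n - dual_mat A B * (dual_mat A B)\<^sup>#) = 0\<^sub>m n n \<longleftrightarrow>
    (1\<^sub>m n - A * G) * C * (1\<^sub>m n - A * G) = 0\<^sub>m n n \<and>
    (1\<^sub>m n - A * G) * (D - B * G * C - C * G * B) * (1\<^sub>m n - A * G) = 0\<^sub>m n n"
proof -
  define N where "N = - (G * B * G) + (G ^\<^sub>m 2) * B * (1\<^sub>m n - A * G) + (1\<^sub>m n - A * G) * B * (G ^\<^sub>m 2)"
  have N: "N \<in> carrier_mat n n"
    unfolding N_def using A G B by (simp add: numeral_2_eq_2 mat_ring_simps)
  have Nx: "N = - (G * (B * G)) + (G * (G * B) - G * (G * (B * (A * G))))
      + (B * (G * G) - A * (G * (B * (G * G))))"
    unfolding N_def using A G B by (simp add: numeral_2_eq_2 mat_ring_simps)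
  define E where "E = 1\<^sub>m n - A * G"
  define M where "M = E * (B * G) + G * (B * E)"
  have E: "E \<in> carrier_mat n n"
    unfolding E_def using A G by (simp add: mat_ring_simps)
  have M: "M \<in> carrier_mat n n"
    unfolding M_def using A G B E by (simp add: mat_ring_simps)
  \<comment> \<open>In \<open>A N\<close> the last summand vanishes by \<open>A E = 0\<close> and
    the middle one shortens by \<open>A G G = G\<close>; adding \<open>B G\<close> completes
    \<open>- A G B G\<close> to \<open>E B G\<close>.\<close>
  have ANB: "A * N + B * G = M"
    unfolding Nx M_def E_def using A G B
    by (intro eq_matI) (simp_all add: mat_ring_simps word_simps del: index_mult_mat(1))
  have inv: "(dual_mat A B)\<^sup># = dual_mat G N"
    unfolding N_def by (rule group_inverse_eqI[OF dual_group_inverse[OF B(1) z]])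
  have "dual_mat A B * (dual_mat A B)\<^sup># = dual_mat (A * G) M"
    unfolding inv ANB[symmetric] using A B(1) G N by (rule mult_dual_mat)
  then have "1\<^sub>m n - dual_mat A B * (dual_mat A B)\<^sup># = dual_mat E (0\<^sub>m n n - M)"
    using A G M by (simp add: one_dual_mat minus_dual_mat[of _ n n] E_def)
  then have *: "(1\<^sub>m n - dual_mat A B * (dual_mat A B)\<^sup>#) * dual_mat C D *
      (1\<^sub>m n - dual_mat A B * (dual_mat A B)\<^sup>#) =
      dual_mat (E * C * E) (E * C * (0\<^sub>m n n - M) + (E * D + (0\<^sub>m n n - M) * C) * E)"
    using E M B by (simp add: mult_dual_mat[of _ n n _ _ n] mat_ring_simps del: assoc_mult_mat)
  \<comment> \<open>\<open>E\<close> stays opaque: the ring laws alone regroup the outer products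
    around the factor \<open>E C E\<close>.\<close>
  have "E * C * (0\<^sub>m n n - M) + (E * D + (0\<^sub>m n n - M) * C) * E =
      E * (D - B * G * C - C * G * B) * E - (E * C * E) * (B * G) - G * B * (E * C * E)"
    unfolding M_def using A G B E
    by (intro eq_matI) (simp_all add: mat_ring_simps del: index_mult_mat(1))
  also have "\<dots> = E * (D - B * G * C - C * G * B) * E" if "E * C * E = 0\<^sub>m n n"
    unfolding that using A G B E by (intro eq_matI) (simp_all add: mat_ring_simps)
  finally show ?thesis
    unfolding * E_def[symmetric] unfolding zero_dual_mat
    using E M B by (subst dual_mat_eq_iff[of _ n n]) (auto simp: mat_ring_simps)
qed

end

end

section \<open>Similarity to a core block form\<close>

lemma det_nonzero_inverse:
  fixes A :: "'a::field mat"
  assumes "A \<in> carrier_mat n n" "det A \<noteq> 0"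
  obtains B where "B \<in> carrier_mat n n" "A * B = 1\<^sub>m n" "B * A = 1\<^sub>m n"
  using det_non_zero_imp_unit[OF assms, of "()"] by (auto simp: Units_def ring_mat_def)

lemma det_swaprows_mat_nonzero:
  assumes "k < n" "l < n"
  shows "det (swaprows_mat n k l :: 'a::field mat) \<noteq> 0"
proof (cases "k = l")
  case True
  then have "swaprows_mat n k l = (1\<^sub>m n :: 'a mat)"
    by (auto simp: swaprows_mat_def)
  then show ?thesis by simp
qed (use assms in \<open>simp add: det_swaprows_mat\<close>)

text \<open>One step of elimination on both sides: a nonzero entry is swapped into the corner,
  scaled to 1, and used to clear its column and its row.\<close>

lemma pivot_reduction:
  fixes A :: "'a::field mat"
  assumes A: "A \<in> carrier_mat (Suc n) (Suc n)" "A \<noteq> 0\<^sub>m (Suc n) (Suc n)"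
  obtains S T D where "S \<in> carrier_mat (Suc n) (Suc n)" "T \<in> carrier_mat (Suc n) (Suc n)"
    "det S \<noteq> 0" "det T \<noteq> 0" "D \<in> carrier_mat n n"
    "S * A * T = four_block_mat (1\<^sub>m 1) (0\<^sub>m 1 n) (0\<^sub>m n 1) D"
proof -
  obtain i j where ij: "i < Suc n" "j < Suc n" "A $$ (i, j) \<noteq> 0"
    using A by (metis carrier_matD eq_matI index_zero_mat)
  let ?p = "swaprows_mat (Suc n) 0 i :: 'a mat" and ?q = "swaprows_mat (Suc n) 0 j :: 'a mat"
  define B where "B = ?p * A * ?q"
  have pq: "?p \<in> carrier_mat (Suc n) (Suc n)" "?q \<in> carrier_mat (Suc n) (Suc n)"
    by simp_all
  then have B: "B \<in> carrier_mat (Suc n) (Suc n)"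
    using A unfolding B_def by (metis mult_carrier_mat)
  have "B = swapcols 0 j (swaprows 0 i A)"
    unfolding B_def using A ij
    by (subst swapcols_mat[of _ "Suc n" "Suc n"]) (auto simp: swaprows_mat[of _ "Suc n" "Suc n"])
  then have B00: "B $$ (0, 0) = A $$ (i, j)"
    using A ij by auto
  obtain a b c d where split: "split_block B 1 1 = (a, b, c, d)"
    by (metis prod_cases4)
  note blk = split_block[OF split, of n n]
  have abcd: "a \<in> carrier_mat 1 1" "b \<in> carrier_mat 1 n" "c \<in> carrier_mat n 1" "d \<in> carrier_mat n n"
    and B_eq: "B = four_block_mat a b c d"
    using blk B by auto
  define u where "u = inverse (A $$ (i, j))"
  have "a $$ (0, 0) = A $$ (i, j)"
    using B00 abcd unfolding B_eq by simp
  then have a: "u \<cdot>\<^sub>m a = 1\<^sub>m 1"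
    using abcd ij by (intro eq_matI) (auto simp: u_def)
  \<comment> \<open>\<open>L\<close> scales the pivot row by \<open>u\<close> and clears the column
    below the pivot; \<open>R\<close> clears the rest of the row. What remains is \<open>D\<close>,
    the Schur complement of the pivot. Both are block triangular, with determinants \<open>u\<close>
    and 1.\<close>
  define L where "L = four_block_mat (u \<cdot>\<^sub>m 1\<^sub>m 1) (0\<^sub>m 1 n) (- (u \<cdot>\<^sub>m c)) (1\<^sub>m n)"
  define R where "R = four_block_mat (1\<^sub>m 1) (- (u \<cdot>\<^sub>m b)) (0\<^sub>m n 1) (1\<^sub>m n)"
  define D where "D = - (u \<cdot>\<^sub>m c) * b + d"
  have D: "D \<in> carrier_mat n n"
    using abcd by (simp add: D_def)
  have ca: "u \<cdot>\<^sub>m c * a = c"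
    using abcd a
    by (metis mult_smult_assoc_mat mult_smult_distrib right_mult_one_mat)
  have LB: "L * B = four_block_mat (1\<^sub>m 1) (u \<cdot>\<^sub>m b) (0\<^sub>m n 1) D"
    unfolding L_def B_eq D_def using abcd a
    by (subst mult_four_block_mat[of _ 1 1 _ n _ n _ _ 1 _ n])
      (auto simp: ca mult_smult_assoc_mat[of _ 1 1] uminus_l_inv_mat[of _ n 1])
  have "(L * B) * R = four_block_mat (1\<^sub>m 1) (0\<^sub>m 1 n) (0\<^sub>m n 1) D"
    unfolding LB R_def using abcd D
    by (subst mult_four_block_mat[of _ 1 1 _ n _ n _ _ 1 _ n])
      (auto simp: uminus_l_inv_mat[of _ 1 n])
  moreover have LR: "L \<in> carrier_mat (Suc n) (Suc n)" "R \<in> carrier_mat (Suc n) (Suc n)"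
    unfolding L_def R_def using abcd four_block_carrier_mat[of _ 1 1 _ n n] by auto
  ultimately have "(L * ?p) * A * (?q * R) = four_block_mat (1\<^sub>m 1) (0\<^sub>m 1 n) (0\<^sub>m n 1) D"
    using A B_def
    by (simp add: assoc_mult_mat[of _ "Suc n" "Suc n" _ "Suc n" _ "Suc n"]
        mult_carrier_mat[of _ "Suc n" "Suc n" _ "Suc n"])
  moreover have "det L \<noteq> 0"
    unfolding L_def using abcd ij
    by (subst det_four_block_mat_upper_right_zero[of _ 1 _ n]) (auto simp: u_def)
  moreover have "det R \<noteq> 0"
    unfolding R_def using abcd
    by (subst det_four_block_mat_lower_left_zero[of _ 1 _ n]) auto
  moreover have "det ?p \<noteq> 0" "det ?q \<noteq> 0"
    using ij by (simp_all add: det_swaprows_mat_nonzero)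
  ultimately show thesis
    using that[of "L * ?p" "?q * R" D] LR D pq
    by (simp add: det_mult[of _ "Suc n"] mult_carrier_mat[of _ "Suc n" "Suc n" _ "Suc n"])
qed

text \<open>Induction on the size: after one pivot step the induction hypothesis is applied to the
  remaining block, and a zero matrix ends the process with \<open>r = 0\<close>.\<close>

lemma rank_normal_form:
  fixes A :: "'a::field mat"
  assumes "A \<in> carrier_mat n n"
  shows "\<exists>r S T. r \<le> n \<and> S \<in> carrier_mat n n \<and> T \<in> carrier_mat n n \<and> det S \<noteq> 0 \<and> det T \<noteq> 0 \<and>
    S * A * T = four_block_mat (1\<^sub>m r) (0\<^sub>m r (n - r)) (0\<^sub>m (n - r) r) (0\<^sub>m (n - r) (n - r))"
  using assms
proof (induction n arbitrary: A)
  case 0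
  show ?case
    by (rule exI[of _ 0], rule exI[of _ "1\<^sub>m 0"], rule exI[of _ "1\<^sub>m 0"])
      (use 0 in \<open>auto intro!: eq_matI\<close>)
next
  case (Suc n)
  show ?case
  proof (cases "A = 0\<^sub>m (Suc n) (Suc n)")
    case True
    show ?thesis
      by (rule exI[of _ 0], rule exI[of _ "1\<^sub>m (Suc n)"], rule exI[of _ "1\<^sub>m (Suc n)"])
        (auto simp: True intro!: eq_matI)
  next
    case False
    obtain S T D where ST: "S \<in> carrier_mat (Suc n) (Suc n)" "T \<in> carrier_mat (Suc n) (Suc n)"
      "det S \<noteq> 0" "det T \<noteq> 0" and D: "D \<in> carrier_mat n n"
      and SAT: "S * A * T = four_block_mat (1\<^sub>m 1) (0\<^sub>m 1 n) (0\<^sub>m n 1) D"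
      using pivot_reduction[OF Suc.prems False] by blast
    obtain r S' T' where r: "r \<le> n" and ST': "S' \<in> carrier_mat n n" "T' \<in> carrier_mat n n"
      "det S' \<noteq> 0" "det T' \<noteq> 0"
      and S'DT': "S' * D * T' =
        four_block_mat (1\<^sub>m r) (0\<^sub>m r (n - r)) (0\<^sub>m (n - r) r) (0\<^sub>m (n - r) (n - r))"
      using Suc.IH[OF D] by blast
    \<comment> \<open>Bordering by a corner 1 is multiplicative and keeps the determinant, so it
      lifts the transformations of the smaller block without touching the pivot.\<close>
    define E where "E X = four_block_mat (1\<^sub>m 1) (0\<^sub>m 1 n) (0\<^sub>m n 1) X" for X :: "'a mat"
    have E: "E X \<in> carrier_mat (Suc n) (Suc n)" "det (E X) = det X" "E X * E Y = E (X * Y)"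
      if "X \<in> carrier_mat n n" "Y \<in> carrier_mat n n" for X Y
    proof -
      show "E X \<in> carrier_mat (Suc n) (Suc n)"
        unfolding E_def using that four_block_carrier_mat[of _ 1 1 X n n] by simp
      show "det (E X) = det X"
        unfolding E_def using that by (subst det_four_block_mat_upper_right_zero[of _ 1 _ n]) auto
      show "E X * E Y = E (X * Y)"
        unfolding E_def using that
        by (subst mult_four_block_mat[of _ 1 1 _ n _ n _ _ 1 _ n]) auto
    qed
    have "(E S' * S) * A * (T * E T') = E S' * (S * A * T) * E T'"
      using ST ST' E Suc.prems
      by (simp add: assoc_mult_mat[of _ "Suc n" "Suc n" _ "Suc n" _ "Suc n"]
          mult_carrier_mat[of _ "Suc n" "Suc n" _ "Suc n"])
    also have "\<dots> = E (S' * D * T')"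
      using ST' D E(3)[of S' D] E(3)[of "S' * D" T'] by (simp only: SAT E_def[symmetric] mult_carrier_mat)
    \<comment> \<open>The corner 1 joins the identity block; the zero block keeps its size because
      \<open>Suc n - Suc r = n - r\<close>.\<close>
    also have "\<dots> = four_block_mat (1\<^sub>m (Suc r)) (0\<^sub>m (Suc r) (Suc n - Suc r))
        (0\<^sub>m (Suc n - Suc r) (Suc r)) (0\<^sub>m (Suc n - Suc r) (Suc n - Suc r))"
      unfolding E_def S'DT' using r by (intro eq_matI) auto
    finally have "(E S' * S) * A * (T * E T') = \<dots>" .
    moreover have "det (E S' * S) \<noteq> 0" "det (T * E T') \<noteq> 0"
      using ST ST' E by (simp_all add: det_mult[of _ "Suc n"])
    ultimately show ?thesis
      using r ST ST' E
      by (intro exI[of _ "Suc r"] exI[of _ "E S' * S"] exI[of _ "T * E T'"])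
        (auto intro!: mult_carrier_mat[of _ "Suc n" "Suc n" _ "Suc n"])
  qed
qed

text \<open>From \<open>S A T = J\<close> one gets that \<open>A\<close> is similar to
  \<open>W J\<close>, whose last columns vanish. The equation \<open>A A X = A\<close> makes the
  upper left block \<open>U\<close> of \<open>W\<close> invertible, and then a unipotent conjugation
  removes the block below it, leaving \<open>diag(U, 0)\<close>.\<close>

lemma core_normal_form:
  fixes A :: "'a::field mat"
  assumes A: "A \<in> carrier_mat n n" and X: "X \<in> carrier_mat n n" and AAX: "A * A * X = A"
  obtains r P Q C C' where "r \<le> n" "P \<in> carrier_mat n n" "Q \<in> carrier_mat n n"
    "P * Q = 1\<^sub>m n" "Q * P = 1\<^sub>m n" "C \<in> carrier_mat r r" "C' \<in> carrier_mat r r"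
    "C * C' = 1\<^sub>m r" "C' * C = 1\<^sub>m r"
    "A = P * four_block_mat C (0\<^sub>m r (n - r)) (0\<^sub>m (n - r) r) (0\<^sub>m (n - r) (n - r)) * Q"
proof -
  obtain r S T where r: "r \<le> n" and ST: "S \<in> carrier_mat n n" "T \<in> carrier_mat n n"
    "det S \<noteq> 0" "det T \<noteq> 0"
    and SAT: "S * A * T =
      four_block_mat (1\<^sub>m r) (0\<^sub>m r (n - r)) (0\<^sub>m (n - r) r) (0\<^sub>m (n - r) (n - r))"
    using rank_normal_form[OF A] by blast
  define m where "m = n - r"
  have n: "n = r + m"
    using r by (simp add: m_def)
  define J :: "'a mat" where "J = four_block_mat (1\<^sub>m r) (0\<^sub>m r m) (0\<^sub>m m r) (0\<^sub>m m m)"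
  obtain Si where Si: "Si \<in> carrier_mat n n" "S * Si = 1\<^sub>m n" "Si * S = 1\<^sub>m n"
    using det_nonzero_inverse[OF ST(1,3)] .
  obtain Ti where Ti: "Ti \<in> carrier_mat n n" "T * Ti = 1\<^sub>m n" "Ti * T = 1\<^sub>m n"
    using det_nonzero_inverse[OF ST(2,4)] .
  note sq = assoc_mult_mat[of _ n n _ n _ n] mult_carrier_mat[of _ n n _ n]
  have cancel: "S * (Si * Z) = Z" "Si * (S * Z) = Z" "T * (Ti * Z) = Z" "Ti * (T * Z) = Z"
    if "Z \<in> carrier_mat n n" for Z
    using that Si Ti ST by (simp_all flip: sq(1))
  have SAT: "S * (A * T) = J"
    using SAT ST A by (simp add: J_def m_def sq)
  have J: "J \<in> carrier_mat n n"
    unfolding J_def n by (rule four_block_carrier_mat) auto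
  have "Ti * A * T = Ti * Si * J"
    unfolding SAT[symmetric] using A ST Si Ti by (simp add: sq cancel)
  moreover define W where "W = Ti * Si"
  ultimately have TAT: "Ti * A * T = W * J" by simp
  have W: "W \<in> carrier_mat n n"
    using Si Ti by (simp add: W_def sq)
  define X' where "X' = Ti * X * T"
  have X': "X' \<in> carrier_mat n n"
    using ST X Ti by (simp add: X'_def sq)
  \<comment> \<open>\<open>T * Ti\<close> is inserted between the two factors \<open>A\<close> and
    again before \<open>X\<close>, so that each factor becomes expressible through \<open>J\<close>,
    \<open>W\<close> and \<open>X'\<close>.\<close>
  have "J = S * (A * A * X) * T"
    using SAT AAX ST A X by (simp add: sq)
  also have "\<dots> = S * (A * T) * (Ti * A * T) * X'"
    using ST A X Ti by (simp add: X'_def sq cancel)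
  also have "\<dots> = J * (W * J) * X'"
    by (simp add: SAT TAT)
  finally have J_eq: "J = J * (W * J) * X'" .
  obtain U U2 V V2 where "split_block W r r = (U, U2, V, V2)"
    by (metis prod_cases4)
  from split_block[OF this, of m m] W n
  have UV: "U \<in> carrier_mat r r" "U2 \<in> carrier_mat r m" "V \<in> carrier_mat m r" "V2 \<in> carrier_mat m m"
    and W_eq: "W = four_block_mat U U2 V V2" by auto
  obtain X1 X2 X3 X4 where "split_block X' r r = (X1, X2, X3, X4)"
    by (metis prod_cases4)
  from split_block[OF this, of m m] X' n
  have Xi: "X1 \<in> carrier_mat r r" "X2 \<in> carrier_mat r m" "X3 \<in> carrier_mat m r" "X4 \<in> carrier_mat m m"
    and X'_eq: "X' = four_block_mat X1 X2 X3 X4" by auto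
  have WJ: "W * J = four_block_mat U (0\<^sub>m r m) V (0\<^sub>m m m)"
    unfolding W_eq J_def using UV by (subst mult_four_block_mat[of _ r r _ m _ m _ _ r _ m]) auto
  have JWJ: "J * (W * J) = four_block_mat U (0\<^sub>m r m) (0\<^sub>m m r) (0\<^sub>m m m)"
    unfolding WJ unfolding J_def using UV by (subst mult_four_block_mat[of _ r r _ m _ m _ _ r _ m]) auto
  have "J * (W * J) * X' = four_block_mat (U * X1) (U * X2) (0\<^sub>m m r) (0\<^sub>m m m)"
    unfolding JWJ X'_eq using UV Xi
    by (subst mult_four_block_mat[of _ r r _ m _ m _ _ r _ m]) auto
  then have *: "four_block_mat (1\<^sub>m r) (0\<^sub>m r m) (0\<^sub>m m r) (0\<^sub>m m m) =
      four_block_mat (U * X1) (U * X2) (0\<^sub>m m r) (0\<^sub>m m m)"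
    using J_eq J_def by simp
  \<comment> \<open>Comparing upper left blocks gives a right inverse of \<open>U\<close>, which for
    square matrices over a field is two-sided.\<close>
  have UX: "U * X1 = 1\<^sub>m r"
  proof (rule eq_matI)
    fix i j assume "i < dim_row (1\<^sub>m r :: 'a mat)" "j < dim_col (1\<^sub>m r :: 'a mat)"
    then show "(U * X1) $$ (i, j) = 1\<^sub>m r $$ (i, j)"
      using arg_cong[OF *, of "\<lambda>M. M $$ (i, j)"] UV Xi by (simp del: index_mult_mat(1))
  qed (use UV Xi in auto)
  have XU: "X1 * U = 1\<^sub>m r"
    using mat_mult_left_right_inverse[OF UV(1) Xi(1) UX] .
  \<comment> \<open>The entry \<open>V * X1\<close> is chosen so that
    \<open>(V * X1) * U = V\<close>: thus \<open>K\<close> rebuilds the first block column of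
    \<open>W * J\<close> from \<open>diag(U, 0)\<close>, and \<open>K'\<close> is its
    inverse.\<close>
  define K where "K = four_block_mat (1\<^sub>m r) (0\<^sub>m r m) (V * X1) (1\<^sub>m m)"
  define K' where "K' = four_block_mat (1\<^sub>m r) (0\<^sub>m r m) (- (V * X1)) (1\<^sub>m m)"
  define N where "N = four_block_mat U (0\<^sub>m r m) (0\<^sub>m m r) (0\<^sub>m m m)"
  have VX: "V * X1 \<in> carrier_mat m r"
    using UV Xi by simp
  have KK: "K \<in> carrier_mat n n" "K' \<in> carrier_mat n n" "N \<in> carrier_mat n n"
    unfolding K_def K'_def N_def n using UV Xi by (auto intro!: four_block_carrier_mat)
  have "K * K' = 1\<^sub>m n"
    unfolding K_def K'_def n using VX uminus_carrier_mat[OF VX]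
    by (subst mult_four_block_mat[of _ r r _ m _ m _ _ r _ m])
      (auto simp: add_uminus_minus_mat[OF VX VX] left_mult_one_mat[of _ m r]
        right_mult_one_mat[of _ m r] left_mult_zero_mat[of _ m] right_mult_zero_mat[of _ m])
  moreover from this have "K' * K = 1\<^sub>m n"
    using mat_mult_left_right_inverse[OF KK(1,2)] by simp
  ultimately have KK1: "K * K' = 1\<^sub>m n" "K' * K = 1\<^sub>m n" .
  have KN: "K * N = W * J"
    unfolding K_def N_def WJ using UV Xi XU
    by (subst mult_four_block_mat[of _ r r _ m _ m _ _ r _ m]) auto
  have NK: "N * K' = N"
  proof -
    have z: "- 0\<^sub>m i j = (0\<^sub>m i j :: 'a mat)" for i j
      by (intro eq_matI) auto
    show ?thesis
      unfolding K'_def N_def using UV Xi VX uminus_carrier_mat[OF VX]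
      by (subst mult_four_block_mat[of _ r r _ m _ m _ _ r _ m])
        (simp_all add: left_mult_zero_mat[of _ m] z)
  qed
  have "A = T * (Ti * A * T) * Ti"
    using A ST Ti by (simp add: sq cancel)
  \<comment> \<open>Because \<open>N * K' = N\<close>, the factor \<open>K'\<close> may be appended
    freely, which turns \<open>K * N\<close> into a conjugate of \<open>N\<close>.\<close>
  also have "\<dots> = (T * K) * N * (K' * Ti)"
  proof -
    have "N * (K' * Ti) = N * Ti"
      using KK Ti NK by (metis assoc_mult_mat)
    then show ?thesis
      unfolding TAT KN[symmetric] using ST Ti KK by (simp add: sq)
  qed
  finally have "A = (T * K) * N * (K' * Ti)" .
  moreover have "(T * K) * (K' * Ti) = 1\<^sub>m n" "(K' * Ti) * (T * K) = 1\<^sub>m n"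
  proof -
    have "(T * K) * (K' * Ti) = T * (K * K') * Ti"
      using ST Ti KK by (simp add: sq)
    then show "(T * K) * (K' * Ti) = 1\<^sub>m n"
      using KK1 ST Ti by simp
    then show "(K' * Ti) * (T * K) = 1\<^sub>m n"
      by (rule mat_mult_left_right_inverse[rotated 2]) (use ST Ti KK in \<open>simp_all add: sq\<close>)
  qed
  ultimately show thesis
    using that[of r "T * K" "K' * Ti" U X1] r ST Ti KK UV Xi UX XU
    by (simp add: N_def m_def sq)
qed

section \<open>Block coordinates\<close>

lemma minv_eq:
  assumes "P \<in> carrier_mat n n" "Q \<in> carrier_mat n n" "P * Q = 1\<^sub>m n" "Q * P = 1\<^sub>m n"
  shows "invertible_mat P" "minv P = Q"
proof -
  show "invertible_mat P"
    using assms by (auto simp: invertible_mat_def inverts_mat_def)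
  have "P \<in> Units (ring_mat TYPE(real) n ())"
    using assms by (auto simp: Units_def ring_mat_def)
  then obtain R where R: "mat_inverse P = Some R"
    using mat_inverse(1)[OF assms(1)] by fastforce
  note PR = mat_inverse(2)[OF assms(1) R]
  have "R = (Q * P) * R"
    unfolding assms(4) using PR by (simp add: left_mult_one_mat[of _ n n])
  also have "\<dots> = Q * (P * R)"
    using assms PR by (intro assoc_mult_mat[of _ n n _ n _ n]) auto
  also have "\<dots> = Q"
    using PR assms(2) by simp
  finally show "minv P = Q"
    using R by simp
qed

lemma minv_inverse:
  assumes P: "P \<in> carrier_mat n n" "invertible_mat P"
  shows "minv P \<in> carrier_mat n n" "P * minv P = 1\<^sub>m n" "minv P * P = 1\<^sub>m n"
proof -
  obtain Q where Q: "P * Q = 1\<^sub>m n" "Q * P = 1\<^sub>m (dim_row Q)"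
    using P by (auto simp: invertible_mat_def inverts_mat_def)
  \<comment> \<open>\<open>invertible_mat\<close> leaves the shape of the witness open; counting
    columns in both product equations recovers it.\<close>
  have "Q \<in> carrier_mat n n"
    using P(1) arg_cong[OF Q(1), of dim_col] arg_cong[OF Q(2), of dim_col] by auto
  with Q minv_eq[OF P(1), of Q] show "minv P \<in> carrier_mat n n" "P * minv P = 1\<^sub>m n" "minv P * P = 1\<^sub>m n"
    by auto
qed

text \<open>Each column of \<open>A\<close> is the image of a unit vector, hence has a preimage
  under \<open>B\<close>; these preimages are the columns of \<open>X\<close>. No division occurs,
  so the argument is available over the dual numbers.\<close>

lemma mat_range_subset_factor:
  assumes A: "A \<in> carrier_mat n m" and B: "B \<in> carrier_mat n k"
    and sub: "mat_range A \<subseteq> mat_range B"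
  obtains X where "X \<in> carrier_mat k m" "B * X = A"
proof -
  have "\<exists>x. x \<in> carrier_vec k \<and> col A j = B *\<^sub>v x" if "j < m" for j
  proof -
    have "col A j = A *\<^sub>v unit_vec m j"
      using A that by (intro eq_vecI) auto
    then have "col A j \<in> mat_range A"
      using A that by (auto simp: mat_range_def)
    then show ?thesis
      using sub B by (auto simp: mat_range_def)
  qed
  then obtain x where x: "x j \<in> carrier_vec k" "col A j = B *\<^sub>v x j" if "j < m" for j
    by metis
  define X where "X = mat k m (\<lambda>(i, j). x j $ i)"
  have X: "X \<in> carrier_mat k m"
    by (simp add: X_def)
  have "B * X = A"
  proof (rule mat_col_eqI)
    fix j assume "j < dim_col A"
    then have j: "j < m" using A by simp
    have "col X j = x j"
      using x(1)[OF j] j by (intro eq_vecI) (auto simp: X_def)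
    then show "col (B * X) j = col A j"
      by (simp only: col_mult2[OF B X j] x(2)[OF j])
  qed (use A B X in auto)
  with X show thesis by (rule that)
qed

lemma minus_four_block_mat:
  assumes "A \<in> carrier_mat nr1 nc1" "B \<in> carrier_mat nr1 nc2"
    "C \<in> carrier_mat nr2 nc1" "D \<in> carrier_mat nr2 nc2"
    "A' \<in> carrier_mat nr1 nc1" "B' \<in> carrier_mat nr1 nc2"
    "C' \<in> carrier_mat nr2 nc1" "D' \<in> carrier_mat nr2 nc2"
  shows "four_block_mat A B C D - four_block_mat A' B' C' D' =
    four_block_mat (A - A') (B - B') (C - C') (D - D')"
  using assms by (intro eq_matI) auto

section \<open>Conjugation by \<open>P\<close> in block coordinates of sizes \<open>r\<close> and
  \<open>m\<close>\<close>

context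
  fixes n r m :: nat and P Q :: "'a::comm_ring_1 mat"
  assumes n: "n = r + m"
    and P: "P \<in> carrier_mat n n" and Q: "Q \<in> carrier_mat n n"
    and PQ: "P * Q = 1\<^sub>m n" and QP: "Q * P = 1\<^sub>m n"
begin

lemma conj_mult:
  assumes "X \<in> carrier_mat n n" "Y \<in> carrier_mat n n"
  shows "(P * X * Q) * (P * Y * Q) = P * (X * Y) * Q"
proof -
  have "(P * X * Q) * (P * Y * Q) = P * X * (Q * P) * Y * Q"
    using assms P Q by (simp add: assoc_mult_mat[of _ n n _ n _ n] mult_carrier_mat[of _ n n _ n])
  then show ?thesis
    using assms P Q QP by (simp add: assoc_mult_mat[of _ n n _ n _ n] mult_carrier_mat[of _ n n _ n])
qed

lemma conj_minus:
  assumes "X \<in> carrier_mat n n" "Y \<in> carrier_mat n n"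
  shows "P * X * Q - P * Y * Q = P * (X - Y) * Q"
  using assms P Q
  by (simp add: minus_mult_distrib_mat[of _ n n _ _ n] mult_minus_distrib_mat[of _ n n _ n]
      mult_carrier_mat[of _ n n _ n] del: assoc_mult_mat)

lemma conj_inverse:
  assumes "X \<in> carrier_mat n n"
  shows "P * (Q * X * P) * Q = X" "Q * (P * X * Q) * P = X"
proof -
  have "P * (Q * X * P) * Q = (P * Q) * X * (P * Q)" "Q * (P * X * Q) * P = (Q * P) * X * (Q * P)"
    using assms P Q by (simp_all add: assoc_mult_mat[of _ n n _ n _ n] mult_carrier_mat[of _ n n _ n])
  then show "P * (Q * X * P) * Q = X" "Q * (P * X * Q) * P = X"
    using assms PQ QP by simp_all
qed

lemma conj_eq_0_iff:
  assumes "X \<in> carrier_mat n n"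
  shows "P * X * Q = 0\<^sub>m n n \<longleftrightarrow> X = 0\<^sub>m n n"
proof
  assume "P * X * Q = 0\<^sub>m n n"
  then have "Q * (P * X * Q) * P = 0\<^sub>m n n"
    using P Q by simp
  then show "X = 0\<^sub>m n n"
    by (simp only: conj_inverse(2)[OF assms])
qed (use P Q in simp)

private lemmas mult_blocks = mult_four_block_mat[of _ r r _ m _ m _ _ r _ m]

private lemmas minus_blocks = minus_four_block_mat[of _ r r _ m _ m]

lemma blocks_carrier:
  assumes "X1 \<in> carrier_mat r r" "X4 \<in> carrier_mat m m"
  shows "four_block_mat X1 X2 X3 X4 \<in> carrier_mat n n"
  unfolding n using assms by (rule four_block_carrier_mat)

lemma blocks_cases:
  assumes "X \<in> carrier_mat n n"
  obtains X1 X2 X3 X4 where "X1 \<in> carrier_mat r r" "X2 \<in> carrier_mat r m"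
    "X3 \<in> carrier_mat m r" "X4 \<in> carrier_mat m m" "X = P * four_block_mat X1 X2 X3 X4 * Q"
proof -
  obtain X1 X2 X3 X4 where s: "split_block (Q * X * P) r r = (X1, X2, X3, X4)"
    by (metis prod_cases4)
  have "dim_row (Q * X * P) = r + m" "dim_col (Q * X * P) = r + m"
    using P Q n by auto
  from split_block[OF s this] conj_inverse(1)[OF assms] show thesis
    by (intro that) auto
qed

text \<open>In the basis given by \<open>P\<close>, left multiplication by \<open>E\<close> erases
  the upper block row and right multiplication the left block column, so only \<open>X4\<close>
  survives.\<close>

lemma block_projection_eq_0_iff:
  fixes X1 X2 X3 X4 :: "'a mat"
  assumes "X1 \<in> carrier_mat r r" "X2 \<in> carrier_mat r m" "X3 \<in> carrier_mat m r" "X4 \<in> carrier_mat m m"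
  defines "E \<equiv> P * four_block_mat (0\<^sub>m r r) (0\<^sub>m r m) (0\<^sub>m m r) (1\<^sub>m m) * Q"
  shows "E * (P * four_block_mat X1 X2 X3 X4 * Q) * E = 0\<^sub>m n n \<longleftrightarrow> X4 = 0\<^sub>m m m"
proof -
  have 1: "four_block_mat (0\<^sub>m r r) (0\<^sub>m r m) (0\<^sub>m m r) (1\<^sub>m m) * four_block_mat X1 X2 X3 X4 =
      four_block_mat (0\<^sub>m r r) (0\<^sub>m r m) X3 X4"
    using assms by (subst mult_blocks) auto
  have 2: "four_block_mat (0\<^sub>m r r) (0\<^sub>m r m) X3 X4 * four_block_mat (0\<^sub>m r r) (0\<^sub>m r m) (0\<^sub>m m r) (1\<^sub>m m) =
      four_block_mat (0\<^sub>m r r) (0\<^sub>m r m) (0\<^sub>m m r) X4"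
    using assms by (subst mult_blocks) auto
  have "E * (P * four_block_mat X1 X2 X3 X4 * Q) * E =
      P * four_block_mat (0\<^sub>m r r) (0\<^sub>m r m) (0\<^sub>m m r) X4 * Q"
    unfolding E_def using assms(1-4)
    by (simp only: conj_mult blocks_carrier one_carrier_mat zero_carrier_mat 1 2)
  also have "\<dots> = 0\<^sub>m n n \<longleftrightarrow> four_block_mat (0\<^sub>m r r) (0\<^sub>m r m) (0\<^sub>m m r) X4 = 0\<^sub>m n n"
    using assms by (intro conj_eq_0_iff blocks_carrier) auto
  also have "\<dots> \<longleftrightarrow> X4 = 0\<^sub>m m m"
  proof
    assume *: "four_block_mat (0\<^sub>m r r) (0\<^sub>m r m) (0\<^sub>m m r) X4 = 0\<^sub>m n n"
    show "X4 = 0\<^sub>m m m"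
    proof (rule eq_matI)
      fix i j assume "i < dim_row (0\<^sub>m m m :: 'a mat)" "j < dim_col (0\<^sub>m m m :: 'a mat)"
      then show "X4 $$ (i, j) = 0\<^sub>m m m $$ (i, j)"
        using arg_cong[OF *, of "\<lambda>M. M $$ (r + i, r + j)"] assms n by simp
    qed (use assms in auto)
  qed (simp add: n)
  finally show ?thesis .
qed

section \<open>The group inverse of \<open>diag(C, 0)\<close> and the conditions in blocks\<close>

context
  fixes C C' :: "'a mat"
  assumes C: "C \<in> carrier_mat r r" and C': "C' \<in> carrier_mat r r"
    and CC': "C * C' = 1\<^sub>m r" and C'C: "C' * C = 1\<^sub>m r"
begin

lemma block_group_inverse:
  "is_group_inverse (P * four_block_mat C (0\<^sub>m r m) (0\<^sub>m m r) (0\<^sub>m m m) * Q)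
    (P * four_block_mat C' (0\<^sub>m r m) (0\<^sub>m m r) (0\<^sub>m m m) * Q)"
proof -
  have *: "four_block_mat U (0\<^sub>m r m) (0\<^sub>m m r) (0\<^sub>m m m) * four_block_mat V (0\<^sub>m r m) (0\<^sub>m m r) (0\<^sub>m m m) =
      four_block_mat (U * V) (0\<^sub>m r m) (0\<^sub>m m r) (0\<^sub>m m m)"
    if "U \<in> carrier_mat r r" "V \<in> carrier_mat r r" for U V :: "'a mat"
    using that by (subst mult_blocks) auto
  have "P * four_block_mat U (0\<^sub>m r m) (0\<^sub>m m r) (0\<^sub>m m m) * Q \<in> carrier_mat n n"
    if "U \<in> carrier_mat r r" for U :: "'a mat"
    using that P Q by (auto intro!: mult_carrier_mat[of _ n n _ n] blocks_carrier)
  with C C' show ?thesis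
    unfolding is_group_inverse_def
    by (simp add: conj_mult blocks_carrier * CC' C'C del: assoc_mult_mat) blast
qed

lemma block_projector:
  "1\<^sub>m n - (P * four_block_mat C (0\<^sub>m r m) (0\<^sub>m m r) (0\<^sub>m m m) * Q) *
      (P * four_block_mat C' (0\<^sub>m r m) (0\<^sub>m m r) (0\<^sub>m m m) * Q) =
    P * four_block_mat (0\<^sub>m r r) (0\<^sub>m r m) (0\<^sub>m m r) (1\<^sub>m m) * Q"
proof -
  have 1: "1\<^sub>m n = P * four_block_mat (1\<^sub>m r) (0\<^sub>m r m) (0\<^sub>m m r) (1\<^sub>m m) * Q"
    using P PQ by (simp flip: n)
  have "four_block_mat C (0\<^sub>m r m) (0\<^sub>m m r) (0\<^sub>m m m) * four_block_mat C' (0\<^sub>m r m) (0\<^sub>m m r) (0\<^sub>m m m) =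
      four_block_mat (1\<^sub>m r) (0\<^sub>m r m) (0\<^sub>m m r) (0\<^sub>m m m)"
    using C C' by (subst mult_blocks) (auto simp: CC')
  moreover have "four_block_mat (1\<^sub>m r) (0\<^sub>m r m) (0\<^sub>m m r) (1\<^sub>m m) - four_block_mat (1\<^sub>m r) (0\<^sub>m r m) (0\<^sub>m m r) (0\<^sub>m m m)
      = four_block_mat (0\<^sub>m r r) (0\<^sub>m r m) (0\<^sub>m m r) (1\<^sub>m m :: 'a mat)"
    by (subst minus_blocks) (auto intro!: eq_matI cong_four_block_mat)
  ultimately show ?thesis
    unfolding 1 using C C' by (simp only: conj_mult conj_minus blocks_carrier one_carrier_mat zero_carrier_mat)
qed

text \<open>\<open>G\<close> lives in the upper left block, so the lower right block of
  \<open>B G Y\<close> is \<open>B3 C' Y2\<close> and that of \<open>Y G B\<close> is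
  \<open>Y3 C' B2\<close>; the projector \<open>E\<close> selects exactly these.\<close>

lemma block_schur:
  fixes B1 B2 B3 Y1 Y2 Y3 Z1 Z2 Z3 Z4 :: "'a mat"
  assumes c: "B1 \<in> carrier_mat r r" "B2 \<in> carrier_mat r m" "B3 \<in> carrier_mat m r"
    "Y1 \<in> carrier_mat r r" "Y2 \<in> carrier_mat r m" "Y3 \<in> carrier_mat m r"
    "Z1 \<in> carrier_mat r r" "Z2 \<in> carrier_mat r m" "Z3 \<in> carrier_mat m r" "Z4 \<in> carrier_mat m m"
  defines "E \<equiv> P * four_block_mat (0\<^sub>m r r) (0\<^sub>m r m) (0\<^sub>m m r) (1\<^sub>m m) * Q"
    and "G \<equiv> P * four_block_mat C' (0\<^sub>m r m) (0\<^sub>m m r) (0\<^sub>m m m) * Q"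
    and "B \<equiv> P * four_block_mat B1 B2 B3 (0\<^sub>m m m) * Q"
    and "Y \<equiv> P * four_block_mat Y1 Y2 Y3 (0\<^sub>m m m) * Q"
    and "Z \<equiv> P * four_block_mat Z1 Z2 Z3 Z4 * Q"
  shows "E * (Z - B * G * Y - Y * G * B) * E = 0\<^sub>m n n \<longleftrightarrow> Z4 = B3 * C' * Y2 + Y3 * C' * B2"
proof -
  have *: "four_block_mat U1 U2 U3 (0\<^sub>m m m) * four_block_mat C' (0\<^sub>m r m) (0\<^sub>m m r) (0\<^sub>m m m) *
      four_block_mat V1 V2 V3 (0\<^sub>m m m) =
      four_block_mat (U1 * C' * V1) (U1 * C' * V2) (U3 * C' * V1) (U3 * C' * V2)"
    if "U1 \<in> carrier_mat r r" "U2 \<in> carrier_mat r m" "U3 \<in> carrier_mat m r"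
      "V1 \<in> carrier_mat r r" "V2 \<in> carrier_mat r m" "V3 \<in> carrier_mat m r" for U1 U2 U3 V1 V2 V3 :: "'a mat"
  proof -
    have "four_block_mat U1 U2 U3 (0\<^sub>m m m) * four_block_mat C' (0\<^sub>m r m) (0\<^sub>m m r) (0\<^sub>m m m) =
        four_block_mat (U1 * C') (0\<^sub>m r m) (U3 * C') (0\<^sub>m m m)"
      using that C' by (subst mult_blocks) auto
    then show ?thesis
      using that C' by (simp del: assoc_mult_mat, subst mult_blocks) (auto simp del: assoc_mult_mat)
  qed
  have cU: "U1 * C' * V1 \<in> carrier_mat r r" "U1 * C' * V2 \<in> carrier_mat r m"
      "U3 * C' * V1 \<in> carrier_mat m r" "U3 * C' * V2 \<in> carrier_mat m m"
    if "U1 \<in> carrier_mat r r" "U3 \<in> carrier_mat m r"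
      "V1 \<in> carrier_mat r r" "V2 \<in> carrier_mat r m" for U1 U3 V1 V2 :: "'a mat"
    using that C' by (auto simp del: assoc_mult_mat intro!: mult_carrier_mat)
  have "Z - B * G * Y - Y * G * B = P * four_block_mat
      (Z1 - B1 * C' * Y1 - Y1 * C' * B1) (Z2 - B1 * C' * Y2 - Y1 * C' * B2)
      (Z3 - B3 * C' * Y1 - Y3 * C' * B1) (Z4 - B3 * C' * Y2 - Y3 * C' * B2) * Q"
    unfolding B_def G_def Y_def Z_def using c C'
    by (simp only: conj_mult conj_minus blocks_carrier mult_carrier_mat[of _ n n _ n] minus_carrier_mat
        zero_carrier_mat * minus_blocks cU)
  then have "E * (Z - B * G * Y - Y * G * B) * E = 0\<^sub>m n n \<longleftrightarrow>
      Z4 - B3 * C' * Y2 - Y3 * C' * B2 = 0\<^sub>m m m"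
    unfolding E_def using c cU
    by (simp only:, subst block_projection_eq_0_iff) (auto simp del: assoc_mult_mat)
  also have "\<dots> \<longleftrightarrow> Z4 = B3 * C' * Y2 + Y3 * C' * B2"
  proof -
    \<comment> \<open>Naming the products keeps them from being expanded in the entrywise
      comparison.\<close>
    define U V where "U = B3 * C' * Y2" and "V = Y3 * C' * B2"
    have UV: "U \<in> carrier_mat m m" "V \<in> carrier_mat m m"
      using c cU unfolding U_def V_def by auto
    have "Z4 - U - V = 0\<^sub>m m m \<longleftrightarrow> Z4 = U + V"
    proof
      assume *: "Z4 - U - V = 0\<^sub>m m m"
      show "Z4 = U + V"
      proof (rule eq_matI)
        fix i j assume "i < dim_row (U + V)" "j < dim_col (U + V)"
        then show "Z4 $$ (i, j) = (U + V) $$ (i, j)"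
          using arg_cong[OF *, of "\<lambda>M. M $$ (i, j)"] UV c by (simp add: algebra_simps)
      qed (use UV c in auto)
    qed (use UV in \<open>auto intro!: eq_matI\<close>)
    then show ?thesis by (simp only: U_def V_def)
  qed
  finally show ?thesis .
qed

text \<open>The bridge between (iv) and (ii). It holds for any block form of \<open>A\<close>,
  whichever \<open>P\<close> and \<open>C\<close> produce it, because \<open>A\<^sup>#\<close> is
  determined by \<open>A\<close> alone.\<close>

lemma block_conditions_iff:
  fixes B1 B2 B3 B4 Y1 Y2 Y3 Y4 Z1 Z2 Z3 Z4 :: "'a mat"
  assumes c: "B1 \<in> carrier_mat r r" "B2 \<in> carrier_mat r m" "B3 \<in> carrier_mat m r" "B4 \<in> carrier_mat m m"
    "Y1 \<in> carrier_mat r r" "Y2 \<in> carrier_mat r m" "Y3 \<in> carrier_mat m r" "Y4 \<in> carrier_mat m m"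
    "Z1 \<in> carrier_mat r r" "Z2 \<in> carrier_mat r m" "Z3 \<in> carrier_mat m r" "Z4 \<in> carrier_mat m m"
    and A: "A = P * four_block_mat C (0\<^sub>m r m) (0\<^sub>m m r) (0\<^sub>m m m) * Q"
    and B: "B = P * four_block_mat B1 B2 B3 B4 * Q"
    and Y: "Y = P * four_block_mat Y1 Y2 Y3 Y4 * Q"
    and Z: "Z = P * four_block_mat Z1 Z2 Z3 Z4 * Q"
  shows "(1\<^sub>m n - A * A\<^sup>#) * B * (1\<^sub>m n - A * A\<^sup>#) = 0\<^sub>m n n \<and>
      (1\<^sub>m n - A * A\<^sup>#) * Y * (1\<^sub>m n - A * A\<^sup>#) = 0\<^sub>m n n \<and>
      (1\<^sub>m n - A * A\<^sup>#) * (Z - B * A\<^sup># * Y - Y * A\<^sup># * B) * (1\<^sub>m n - A * A\<^sup>#) = 0\<^sub>m n n \<longleftrightarrow>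
    B4 = 0\<^sub>m m m \<and> Y4 = 0\<^sub>m m m \<and> Z4 = B3 * C' * Y2 + Y3 * C' * B2"
proof -
  have G: "A\<^sup># = P * four_block_mat C' (0\<^sub>m r m) (0\<^sub>m m r) (0\<^sub>m m m) * Q"
    unfolding A by (rule group_inverse_eqI[OF block_group_inverse])
  let ?E = "P * four_block_mat (0\<^sub>m r r) (0\<^sub>m r m) (0\<^sub>m m r) (1\<^sub>m m) * Q"
  have E: "1\<^sub>m n - A * A\<^sup># = ?E"
    unfolding G unfolding A by (rule block_projector)
  have "?E * B * ?E = 0\<^sub>m n n \<longleftrightarrow> B4 = 0\<^sub>m m m" "?E * Y * ?E = 0\<^sub>m n n \<longleftrightarrow> Y4 = 0\<^sub>m m m"
    unfolding B Y using c by (simp_all only: block_projection_eq_0_iff)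
  moreover have "?E * (Z - B * A\<^sup># * Y - Y * A\<^sup># * B) * ?E = 0\<^sub>m n n \<longleftrightarrow> Z4 = B3 * C' * Y2 + Y3 * C' * B2"
    if "B4 = 0\<^sub>m m m" "Y4 = 0\<^sub>m m m"
    unfolding G B Y Z that
    by (rule block_schur[OF c(1-3) c(5-7) c(9-12)])
  ultimately show ?thesis
    unfolding E by blast
qed

end

end

section \<open>The equivalences\<close>

text \<open>The third equation of (iv) stands between the projectors like the other two: for
  invertible \<open>A0\<close> the projectors vanish and every \<open>A3\<close> is admissible, so
  the bare equation would be too strong.\<close>

theorem theorem3p3:
  fixes n :: nat
    and A0 A1 A2 A3 :: "real mat"
    and Ah Ah0 :: "dual mat"
    and At :: "hyperdual mat"
  assumes "A0 \<in> carrier_mat n n" "A1 \<in> carrier_mat n n"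
    and "A2 \<in> carrier_mat n n" "A3 \<in> carrier_mat n n"
    and "Ah = dual_mat A0 A1"
    and "Ah0 = dual_mat A2 A3"
    and "At = dual_mat Ah Ah0"
    and "dual_index_one Ah"
  shows
    "(has_group_inverse At \<longleftrightarrow>
       (\<exists>r P C B1 B2 B3 Y1 Y2 Y3 Z1 Z2 Z3 Z4.
          r \<le> n \<and>
          P \<in> carrier_mat n n \<and> invertible_mat P \<and>
          C \<in> carrier_mat r r \<and> invertible_mat C \<and>
          B1 \<in> carrier_mat r r \<and> B2 \<in> carrier_mat r (n - r) \<and> B3 \<in> carrier_mat (n - r) r \<and>
          Y1 \<in> carrier_mat r r \<and> Y2 \<in> carrier_mat r (n - r) \<and> Y3 \<in> carrier_mat (n - r) r \<and>
          Z1 \<in> carrier_mat r r \<and> Z2 \<in> carrier_mat r (n - r) \<and> Z3 \<in> carrier_mat (n - r) r \<and>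
          Z4 \<in> carrier_mat (n - r) (n - r) \<and>
          Z4 = B3 * minv C * Y2 + Y3 * minv C * B2 \<and>
          At =
            dual_mat
              (dual_mat
                (P * four_block_mat C (0\<^sub>m r (n - r)) (0\<^sub>m (n - r) r) (0\<^sub>m (n - r) (n - r)) * minv P)
                (P * four_block_mat B1 B2 B3 (0\<^sub>m (n - r) (n - r)) * minv P))
              (dual_mat
                (P * four_block_mat Y1 Y2 Y3 (0\<^sub>m (n - r) (n - r)) * minv P)
                (P * four_block_mat Z1 Z2 Z3 Z4 * minv P)))) \<and>
     (has_group_inverse At \<longleftrightarrow>
       (1\<^sub>m n - Ah * Ah\<^sup>#) * Ah0 * (1\<^sub>m n - Ah * Ah\<^sup>#) = 0\<^sub>m n n) \<and>
     (has_group_inverse At \<longleftrightarrow>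
       (1\<^sub>m n - A0 * A0\<^sup>#) * A1 * (1\<^sub>m n - A0 * A0\<^sup>#) = 0\<^sub>m n n \<and>
       (1\<^sub>m n - A0 * A0\<^sup>#) * A2 * (1\<^sub>m n - A0 * A0\<^sup>#) = 0\<^sub>m n n \<and>
       (1\<^sub>m n - A0 * A0\<^sup>#) * (A3 - A1 * A0\<^sup># * A2 - A2 * A0\<^sup># * A1) * (1\<^sub>m n - A0 * A0\<^sup>#) = 0\<^sub>m n n) \<and>
     (has_group_inverse At \<longrightarrow>
       At\<^sup># =
         dual_mat (Ah\<^sup>#)
           (- (Ah\<^sup># * Ah0 * Ah\<^sup>#)
            + (Ah\<^sup># ^\<^sub>m 2) * Ah0 * (1\<^sub>m n - Ah * Ah\<^sup>#)
            + (1\<^sub>m n - Ah * Ah\<^sup>#) * Ah0 * (Ah\<^sup># ^\<^sub>m 2)))"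
    (is "(_ \<longleftrightarrow> ?ii) \<and> _")
proof -
  note A = assms(1-4)
  let ?E = "1\<^sub>m n - A0 * A0\<^sup>#"
  have Ah: "Ah \<in> carrier_mat n n" and Ah0: "Ah0 \<in> carrier_mat n n"
    using A assms(5,6) by simp_all
  have Ah2: "Ah ^\<^sub>m 2 = Ah * Ah"
    using Ah by (simp add: numeral_2_eq_2)
  \<comment> \<open>The dual index becomes a matrix equation \<open>Ah * Ah * X = Ah\<close>, whose
    two coefficients are extracted next: \<open>X0\<close> yields the core form of
    \<open>A0\<close>, \<open>X1\<close> the condition on \<open>A1\<close>.\<close>
  have "mat_range Ah \<subseteq> mat_range (Ah * Ah)"
    using assms(8) by (simp add: dual_index_one_def Ah2)
  then obtain X where X: "X \<in> carrier_mat n n" "Ah * Ah * X = Ah"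
    using Ah by (metis mat_range_subset_factor mult_carrier_mat)
  obtain X0 X1 where X01: "X0 \<in> carrier_mat n n" "X1 \<in> carrier_mat n n" "X = dual_mat X0 X1"
    using X(1) by (rule dual_mat_cases)
  note m = mult_carrier_mat[of _ n n _ n] add_carrier_mat[of _ n n] minus_carrier_mat[of _ n n]
  have "Ah * Ah * X = dual_mat (A0 * A0 * X0) (A0 * A0 * X1 + (A0 * A1 + A1 * A0) * X0)"
    unfolding assms(5) X01 using A X01 by (simp add: mult_dual_mat[of _ n n _ _ n] m del: assoc_mult_mat)
  then have "dual_mat (A0 * A0 * X0) (A0 * A0 * X1 + (A0 * A1 + A1 * A0) * X0) = dual_mat A0 A1"
    using X(2) assms(5) by simp
  then have X0: "A0 * A0 * X0 = A0" and X1: "A0 * A0 * X1 + (A0 * A1 + A1 * A0) * X0 = A1"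
    by (subst (asm) dual_mat_eq_iff[of _ n n]; use A X01 in \<open>simp add: m del: assoc_mult_mat\<close>)+
  obtain r P Q C C' where r: "r \<le> n" and P: "P \<in> carrier_mat n n" and Q: "Q \<in> carrier_mat n n"
    and PQ: "P * Q = 1\<^sub>m n" and QP: "Q * P = 1\<^sub>m n"
    and C: "C \<in> carrier_mat r r" and C': "C' \<in> carrier_mat r r"
    and CC': "C * C' = 1\<^sub>m r" and C'C: "C' * C = 1\<^sub>m r"
    and A0: "A0 = P * four_block_mat C (0\<^sub>m r (n - r)) (0\<^sub>m (n - r) r) (0\<^sub>m (n - r) (n - r)) * Q"
    using core_normal_form[OF A(1) X01(1) X0] .
  have "n = r + (n - r)"
    using r by simp
  note blk = this P Q PQ QP C C' CC' C'C
  have "is_group_inverse A0 (A0\<^sup>#)"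
    using block_group_inverse[OF blk] group_inverse_eqI unfolding A0 by metis
  note gi = A(1) this
  \<comment> \<open>The first condition of (iv) thus follows from the dual index, and it supplies
    the group inverse of \<open>Ah\<close>.\<close>
  have z: "?E * A1 * ?E = 0\<^sub>m n n"
    by (rule dual_core_condition[OF gi A(2) X01(1,2) X0 X1])
  have "is_group_inverse Ah (Ah\<^sup>#)"
    using dual_group_inverse[OF gi A(2) z] group_inverse_eqI unfolding assms(5) by metis
  note gih = Ah this
  let ?iii = "(1\<^sub>m n - Ah * Ah\<^sup>#) * Ah0 * (1\<^sub>m n - Ah * Ah\<^sup>#) = 0\<^sub>m n n"
  \<comment> \<open>The general criterion, now with dual numbers as coefficients and
    \<open>Ah\<close>, \<open>Ah0\<close> in the roles of \<open>A\<close>,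
    \<open>B\<close>.\<close>
  have i_iii: "has_group_inverse At \<longleftrightarrow> ?iii"
    using dual_group_inverse[OF gih Ah0] dual_group_inverse_imp[OF gih Ah0]
    unfolding has_group_inverse_def assms(7) by blast
  have formula: "has_group_inverse At \<Longrightarrow> At\<^sup># =
      dual_mat (Ah\<^sup>#)
        (- (Ah\<^sup># * Ah0 * Ah\<^sup>#)
         + (Ah\<^sup># ^\<^sub>m 2) * Ah0 * (1\<^sub>m n - Ah * Ah\<^sup>#)
         + (1\<^sub>m n - Ah * Ah\<^sup>#) * Ah0 * (Ah\<^sup># ^\<^sub>m 2))"
    unfolding i_iii unfolding assms(7) by (intro group_inverse_eqI dual_group_inverse[OF gih Ah0])
  define iv where "iv \<longleftrightarrow> ?E * A1 * ?E = 0\<^sub>m n n \<and> ?E * A2 * ?E = 0\<^sub>m n n \<and>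
    ?E * (A3 - A1 * A0\<^sup># * A2 - A2 * A0\<^sup># * A1) * ?E = 0\<^sub>m n n"
  \<comment> \<open>Over the reals the projector condition gives the last two equations of (iv);
    \<open>z\<close> adds the first.\<close>
  have iii_iv: "?iii \<longleftrightarrow> iv"
    using dual_projector_condition[OF gi A(2-4) z] z unfolding iv_def assms(5,6) by simp
  have At_eq: "At = dual_mat (dual_mat M0 M1) (dual_mat M2 M3) \<longleftrightarrow>
      A0 = M0 \<and> A1 = M1 \<and> A2 = M2 \<and> A3 = M3"
    if "M0 \<in> carrier_mat n n" "M1 \<in> carrier_mat n n" "M2 \<in> carrier_mat n n" "M3 \<in> carrier_mat n n"
    for M0 M1 M2 M3
    unfolding assms(5-7) using A that by (simp add: dual_mat_eq_iff[of _ n n] conj_assoc)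
  have cc: "M * four_block_mat N1 N2 N3 N4 * M' \<in> carrier_mat n n"
    if "s \<le> n" "M \<in> carrier_mat n n" "M' \<in> carrier_mat n n"
      "N1 \<in> carrier_mat s s" "N4 \<in> carrier_mat (n - s) (n - s)"
    for s and M M' N1 N2 N3 N4 :: "real mat"
    using that four_block_carrier_mat[OF that(4,5), of N2 N3] by (auto intro!: m)
  have ii_iv: "?ii \<longleftrightarrow> iv"
  proof
    assume ?ii
    then obtain s R K B1 B2 B3 Y1 Y2 Y3 Z1 Z2 Z3 Z4 where s: "s \<le> n"
      and R: "R \<in> carrier_mat n n" "invertible_mat R"
      and K: "K \<in> carrier_mat s s" "invertible_mat K"
      and c: "B1 \<in> carrier_mat s s" "B2 \<in> carrier_mat s (n - s)" "B3 \<in> carrier_mat (n - s) s"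
        "Y1 \<in> carrier_mat s s" "Y2 \<in> carrier_mat s (n - s)" "Y3 \<in> carrier_mat (n - s) s"
        "Z1 \<in> carrier_mat s s" "Z2 \<in> carrier_mat s (n - s)" "Z3 \<in> carrier_mat (n - s) s"
        "Z4 \<in> carrier_mat (n - s) (n - s)"
      and Z4: "Z4 = B3 * minv K * Y2 + Y3 * minv K * B2"
      and At: "At = dual_mat
          (dual_mat
            (R * four_block_mat K (0\<^sub>m s (n - s)) (0\<^sub>m (n - s) s) (0\<^sub>m (n - s) (n - s)) * minv R)
            (R * four_block_mat B1 B2 B3 (0\<^sub>m (n - s) (n - s)) * minv R))
          (dual_mat
            (R * four_block_mat Y1 Y2 Y3 (0\<^sub>m (n - s) (n - s)) * minv R)
            (R * four_block_mat Z1 Z2 Z3 Z4 * minv R))"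
      by (elim exE conjE)
    note R' = minv_inverse[OF R] and K' = minv_inverse[OF K]
    have n: "n = s + (n - s)"
      using s by simp
    note eqs = At[unfolded At_eq[OF cc[OF s R(1) R'(1) K(1) zero_carrier_mat]
        cc[OF s R(1) R'(1) c(1) zero_carrier_mat] cc[OF s R(1) R'(1) c(4) zero_carrier_mat]
        cc[OF s R(1) R'(1) c(7,10)]]]
    \<comment> \<open>The matrices \<open>R\<close> and \<open>K\<close> need not be the
      \<open>P\<close> and \<open>C\<close> found above, so the block criterion is applied in the
      basis of \<open>R\<close>.\<close>
    show iv
      unfolding iv_def
      by (rule block_conditions_iff[OF n R(1) R' K(1) K' c(1-3) zero_carrier_mat c(4-6) zero_carrier_mat
            c(7-10), THEN iffD2]) (use eqs Z4 in \<open>blast intro: refl\<close>)+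
  next
    assume iv
    \<comment> \<open>All remaining coefficients are written in the basis that brings
      \<open>A0\<close> to its core form; (iv) then fixes the lower right blocks.\<close>
    obtain B1 B2 B3 B4 where B: "B1 \<in> carrier_mat r r" "B2 \<in> carrier_mat r (n - r)"
      "B3 \<in> carrier_mat (n - r) r" "B4 \<in> carrier_mat (n - r) (n - r)"
      and A1: "A1 = P * four_block_mat B1 B2 B3 B4 * Q"
      using blocks_cases[OF blk(1-5) A(2)] .
    obtain Y1 Y2 Y3 Y4 where Y: "Y1 \<in> carrier_mat r r" "Y2 \<in> carrier_mat r (n - r)"
      "Y3 \<in> carrier_mat (n - r) r" "Y4 \<in> carrier_mat (n - r) (n - r)"
      and A2: "A2 = P * four_block_mat Y1 Y2 Y3 Y4 * Q"
      using blocks_cases[OF blk(1-5) A(3)] .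
    obtain Z1 Z2 Z3 Z4 where Z: "Z1 \<in> carrier_mat r r" "Z2 \<in> carrier_mat r (n - r)"
      "Z3 \<in> carrier_mat (n - r) r" "Z4 \<in> carrier_mat (n - r) (n - r)"
      and A3: "A3 = P * four_block_mat Z1 Z2 Z3 Z4 * Q"
      using blocks_cases[OF blk(1-5) A(4)] .
    have *: "B4 = 0\<^sub>m (n - r) (n - r)" "Y4 = 0\<^sub>m (n - r) (n - r)"
        "Z4 = B3 * C' * Y2 + Y3 * C' * B2"
      using \<open>iv\<close> block_conditions_iff[OF blk B Y Z A0 A1 A2 A3] unfolding iv_def by blast+
    \<comment> \<open>The constructed inverses \<open>Q\<close> and \<open>C'\<close> are recognised
      as \<open>minv P\<close> and \<open>minv C\<close>, the form in which (ii) is stated.\<close>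
    note inv = minv_eq[OF P Q PQ QP] minv_eq[OF C C' CC' C'C]
    have At: "At = dual_mat (dual_mat A0 A1) (dual_mat A2 A3)"
      using assms(5-7) by simp
    show ?ii
      by (rule exI[of _ r], rule exI[of _ P], rule exI[of _ C], rule exI[of _ B1], rule exI[of _ B2],
          rule exI[of _ B3], rule exI[of _ Y1], rule exI[of _ Y2], rule exI[of _ Y3],
          rule exI[of _ Z1], rule exI[of _ Z2], rule exI[of _ Z3], rule exI[of _ Z4], unfold inv)
        (intro conjI r P C inv B(1-3) Y(1-3) Z *(3), unfold At, unfold A0 A1 A2 A3 *(1,2), rule refl)
  qed
  show ?thesis
    by (intro conjI impI)
      (rule trans[OF i_iii trans[OF iii_iv ii_iv[symmetric]]], rule i_iii,
        rule trans[OF i_iii iii_iv[unfolded iv_def]], rule formula)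
qed

end
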